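(* Let $m\ge 1$, $T\subseteq\{0,\ldots,m-1\}$, $\Delta_t=m-t$ for $t\in T$, and let $U=\sum_{t\in T}N^{\Delta_t}$ as a linear operator on $\mathbb{F}_2^m$. Then for every integer $k\ge 0$, $$U^{2^k}=\sum_{t\in T}N^{2^k\Delta_t},$$ where shifts by at least $m$ are zero.
   Context: For $d\ge 0$, $N^d$ is the truncated right shift on $\mathbb{F}_2^m$: for $y=(y_0,\ldots,y_{m-1})$, $(N^dy)_i=y_{i+d}$ if $0\le i<m-d$ and $(N^dy)_i=0$ if $m-d\le i<m$; $N^d=0$ for $d\ge m$. Empty sums denote the zero map. *)

theory Defs
  imports "HOL-Library.Z2" "Jordan_Normal_Form.Matrix"
begin

text \<open>The space \<open>\<bbbF>\<^sub>2\<^sup>m\<close> is \<open>carrier_vec m :: bit vec set\<close>; operators on it are functions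
  \<open>bit vec \<Rightarrow> bit vec\<close>, of which only the values on \<open>carrier_vec m\<close> matter.\<close>

text \<open>The operator \<open>N\<^sup>d\<close>. For \<open>d \<ge> m\<close> the truncated difference \<open>m - d\<close> is \<open>0\<close>,
  so the operator is zero.\<close>

definition shift :: "nat \<Rightarrow> nat \<Rightarrow> bit vec \<Rightarrow> bit vec" where
  "shift m d y = vec m (\<lambda>i. if i < m - d then y $ (i + d) else 0)"

definition op_sum :: "nat \<Rightarrow> ('t \<Rightarrow> bit vec \<Rightarrow> bit vec) \<Rightarrow> 't set \<Rightarrow> bit vec \<Rightarrow> bit vec" where
  "op_sum m F T y = finsum_vec TYPE(bit) m (\<lambda>t. F t y) T"

definition U :: "nat \<Rightarrow> nat set \<Rightarrow> bit vec \<Rightarrow> bit vec" where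
  "U m T = op_sum m (\<lambda>t. shift m (m - t)) T"

lemma shift_closed: "shift m d y \<in> carrier_vec m"
  by (simp add: shift_def)

lemma U_closed: "U m T y \<in> carrier_vec m"
  unfolding U_def op_sum_def by (rule finsum_vec_closed) (auto simp: shift_closed)

lemma U_index:
  assumes "finite T" "i < m"
  shows "U m T y $ i = (\<Sum>t\<in>T. shift m (m - t) y $ i)"
  unfolding U_def op_sum_def using assms by (intro index_finsum_vec) (auto simp: shift_closed)

lemma U_add:
  assumes "finite T" "x \<in> carrier_vec m" "y \<in> carrier_vec m"
  shows "U m T (x + y) = U m T x + U m T y"
proof (rule eq_vecI)
  fix i assume "i < dim_vec (U m T x + U m T y)"
  then have i: "i < m" using carrier_vecD[OF U_closed] by simp
  have "shift m d (x + y) $ i = shift m d x $ i + shift m d y $ i" for d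
    using assms i by (simp add: shift_def del: add_bit_eq_xor)
  then show "U m T (x + y) $ i = (U m T x + U m T y) $ i"
    using assms i carrier_vecD[OF U_closed] by (simp add: U_index sum.distrib del: add_bit_eq_xor)
qed (simp add: carrier_vecD[OF U_closed])

lemma U_smult:
  assumes "finite T" "y \<in> carrier_vec m"
  shows "U m T (c \<cdot>\<^sub>v y) = c \<cdot>\<^sub>v U m T y"
proof (rule eq_vecI)
  fix i assume "i < dim_vec (c \<cdot>\<^sub>v U m T y)"
  then have i: "i < m" using carrier_vecD[OF U_closed] by simp
  have "shift m d (c \<cdot>\<^sub>v y) $ i = c * shift m d y $ i" for d
    using assms i by (simp add: shift_def)
  then show "U m T (c \<cdot>\<^sub>v y) $ i = (c \<cdot>\<^sub>v U m T y) $ i"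
    using assms i carrier_vecD[OF U_closed] by (simp add: U_index sum_distrib_left del: mult_bit_eq_and)
qed (simp add: carrier_vecD[OF U_closed])

end

theory Submission
  imports Defs
begin

text \<open>In characteristic 2, squaring a sum of commuting operators squares each summand, because the
  mixed terms occur in equal pairs. As \<open>N\<^sup>a N\<^sup>b = N\<^sup>a\<^sup>+\<^sup>b\<close>, squaring \<open>\<Sum>\<^sub>t N\<^bsup>g t\<^esup>\<close> doubles all
  exponents, and the claim follows by iterating this \<open>k\<close> times.\<close>

lemma bit_add_self: "(b::bit) + b = 0"
  by (cases b) auto

lemma sum_sum_symmetric_bit:
  fixes a :: "'t \<Rightarrow> 't \<Rightarrow> bit"
  assumes "finite T" and sym: "\<And>s t. a s t = a t s"
  shows "(\<Sum>t\<in>T. \<Sum>s\<in>T. a t s) = (\<Sum>t\<in>T. a t t)"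
  using assms(1)
proof (induction T)
  case (insert x T)
  \<comment> \<open>The new index \<open>x\<close> contributes a diagonal entry, a row and a column;
    row and column agree by symmetry of \<open>a\<close>, so together they vanish.\<close>
  have "(\<Sum>t\<in>insert x T. \<Sum>s\<in>insert x T. a t s)
      = a x x + ((\<Sum>s\<in>T. a x s) + (\<Sum>t\<in>T. a t x)) + (\<Sum>t\<in>T. \<Sum>s\<in>T. a t s)"
    using insert.hyps by (simp add: sum.distrib add.assoc del: add_bit_eq_xor)
  also have "(\<Sum>t\<in>T. a t x) = (\<Sum>s\<in>T. a x s)"
    by (simp add: sym[of x])
  finally show ?case
    using insert by (simp add: bit_add_self del: add_bit_eq_xor)
qed simp

lemma op_sum_shift_closed: "op_sum m (\<lambda>t. shift m (g t)) T y \<in> carrier_vec m"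
  unfolding op_sum_def by (rule finsum_vec_closed) (auto simp: shift_closed)

lemma op_sum_shift_index:
  assumes "finite T" "i < m"
  shows "op_sum m (\<lambda>t. shift m (g t)) T y $ i = (\<Sum>t\<in>T. shift m (g t) y $ i)"
  unfolding op_sum_def using assms by (intro index_finsum_vec) (auto simp: shift_closed)

text \<open>Coordinate form of N^d N^e = N^(d+e), combined with linearity of the outer
  shift.\<close>

lemma shift_op_sum_shift_index:
  assumes "finite T" "i < m"
  shows "shift m d (op_sum m (\<lambda>t. shift m (g t)) T y) $ i = (\<Sum>t\<in>T. shift m (d + g t) y $ i)"
proof (cases "i < m - d")
  case True
  then have "i + d < m" by simp
  then have "shift m d (op_sum m (\<lambda>t. shift m (g t)) T y) $ i = (\<Sum>t\<in>T. shift m (g t) y $ (i + d))"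
    using True assms by (simp add: shift_def[of m d] op_sum_shift_index)
  \<comment> \<open>Both sides read \<open>y\<close> at \<open>i + d + g t\<close>, and both vanish
    exactly when this index leaves the vector.\<close>
  also have "\<dots> = (\<Sum>t\<in>T. shift m (d + g t) y $ i)"
    using \<open>i + d < m\<close> assms by (intro sum.cong refl) (auto simp: shift_def add.assoc)
  finally show ?thesis .
next
  case False
  \<comment> \<open>If the outer shift already yields 0 at \<open>i\<close>, then so does every
    longer shift on the right.\<close>
  then have "\<not> i < m - (d + e)" for e by simp
  with False show ?thesis
    using assms by (simp add: shift_def)
qed

text \<open>The exponent \<open>g t + g s\<close> is symmetric in \<open>t\<close> and
  \<open>s\<close>, so only the diagonal survives. Arbitrary \<open>g\<close> lets the result be
  squared again.\<close>

lemma op_sum_shift_square: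
  assumes "finite T"
  shows "op_sum m (\<lambda>t. shift m (g t)) T (op_sum m (\<lambda>t. shift m (g t)) T y)
    = op_sum m (\<lambda>t. shift m (2 * g t)) T y"
proof (rule eq_vecI)
  fix i assume "i < dim_vec (op_sum m (\<lambda>t. shift m (2 * g t)) T y)"
  then have i: "i < m" by (simp add: carrier_vecD[OF op_sum_shift_closed])
  have "op_sum m (\<lambda>t. shift m (g t)) T (op_sum m (\<lambda>t. shift m (g t)) T y) $ i
      = (\<Sum>t\<in>T. \<Sum>s\<in>T. shift m (g t + g s) y $ i)"
    using assms i by (simp add: op_sum_shift_index shift_op_sum_shift_index)
  also have "\<dots> = (\<Sum>t\<in>T. shift m (g t + g t) y $ i)"
    using assms by (rule sum_sum_symmetric_bit) (simp add: add.commute)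
  also have "\<dots> = op_sum m (\<lambda>t. shift m (2 * g t)) T y $ i"
    using assms i by (simp add: op_sum_shift_index mult_2)
  finally show "op_sum m (\<lambda>t. shift m (g t)) T (op_sum m (\<lambda>t. shift m (g t)) T y) $ i
      = op_sum m (\<lambda>t. shift m (2 * g t)) T y $ i" .
qed (simp add: carrier_vecD[OF op_sum_shift_closed])

lemma funpow_op_sum_shift:
  assumes "finite T"
  shows "op_sum m (\<lambda>t. shift m (g t)) T ^^ 2 ^ k = op_sum m (\<lambda>t. shift m (2 ^ k * g t)) T"
proof (induction k)
  case (Suc k)
  \<comment> \<open>Since \<open>2 ^ Suc k = 2 ^ k + 2 ^ k\<close>, the power is a composite of two
    copies of the previous one; squaring then applies with exponents
    \<open>2 ^ k * g t\<close>.\<close>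
  have "op_sum m (\<lambda>t. shift m (g t)) T ^^ 2 ^ Suc k
      = op_sum m (\<lambda>t. shift m (2 ^ k * g t)) T \<circ> op_sum m (\<lambda>t. shift m (2 ^ k * g t)) T"
    by (simp add: mult_2 funpow_add Suc.IH)
  also have "\<dots> = op_sum m (\<lambda>t. shift m (2 ^ Suc k * g t)) T"
    using op_sum_shift_square[OF assms] by (simp add: fun_eq_iff mult.assoc)
  finally show ?case .
qed simp

theorem lemma3p2:
  fixes m k :: nat and T :: "nat set" and y :: "bit vec"
  assumes "m \<ge> 1"
    and "T \<subseteq> {0..m - 1}"
    and "y \<in> carrier_vec m"
  shows "(U m T ^^ (2 ^ k)) y = op_sum m (\<lambda>t. shift m (2 ^ k * (m - t))) T y"
proof -
  have "finite T"
    using assms(2) by (rule finite_subset) simp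
  then show ?thesis
    by (simp add: U_def funpow_op_sum_shift)
qed

end
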